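(* Let $n\in\mathbb{N}$ and let $a_1,\ldots,a_n$ be positive real numbers. Suppose that $a_i\ge 1$ for all $1\le i\le n$, or that $a_1+\cdots+a_n<1$. Then for all real $s,t$ with $n+1<s<t$, \[ \dim_{\mathrm{H}}\left\{\alpha\in[s,t] : y=a_1x_1+\cdots+a_nx_n \text{ has infinitely many non-trivial solutions } (y,x_1,\ldots,x_n)\in\mathrm{PS}(\alpha)^{n+1}\right\}\le \frac{n+1}{s}. \] In addition, for almost every $\alpha>n+1$ (with respect to Lebesgue measure), the equation $y=a_1x_1+\cdots+a_nx_n$ has at most finitely many non-trivial solutions $(y,x_1,\ldots,x_n)\in\mathrm{PS}(\alpha)^{n+1}$.
   Context: For real $\alpha>1$, $\mathrm{PS}(\alpha)=\{\lfloor n^\alpha\rfloor : n\in\mathbb{N}\}$, where $\lfloor x\rfloor$ is the integer part of $x$. $\dim_{\mathrm{H}}$ denotes Hausdorff dimension. For the equation $y=a_1x_1+\cdots+a_nx_n$: if $a_1+\cdots+a_n=1$, a solution with $y=x_1=\cdots=x_n$ is called trivial and all other solutions are non-trivial; if $a_1+\cdots+a_n\ne 1$, all solutions are called non-trivial. *)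

theory Defs
  imports "HOL-Analysis.Analysis"
begin

text \<open>
  The Piatetski-Shapiro sequence as a set of integers. The natural numbers of the
  source are the positive integers, so the index starts at 1 (otherwise 0 would be a
  member, and already y = x1 + x2 would have the solutions (y, y, 0)).
\<close>

definition PS :: "real \<Rightarrow> int set" where
  "PS \<alpha> = {\<lfloor>real k powr \<alpha>\<rfloor> | k :: nat. k \<ge> 1}"

text \<open>
  Pairs (y, x) with y in PS(\<open>\<alpha>\<close>) and x = (x 1, ..., x n) in PS(\<open>\<alpha>\<close>) to the n-th power;
  the extensional function space ensures that each tuple is represented exactly once.
\<close>

definition PS_solutions :: "nat \<Rightarrow> (nat \<Rightarrow> real) \<Rightarrow> real \<Rightarrow> (int \<times> (nat \<Rightarrow> int)) set" where
  "PS_solutions n a \<alpha> =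
     {(y, x). y \<in> PS \<alpha> \<and> x \<in> {1..n} \<rightarrow>\<^sub>E PS \<alpha> \<and>
              real_of_int y = (\<Sum>i=1..n. a i * real_of_int (x i))}"

definition trivial_solution :: "nat \<Rightarrow> (nat \<Rightarrow> real) \<Rightarrow> int \<times> (nat \<Rightarrow> int) \<Rightarrow> bool" where
  "trivial_solution n a = (\<lambda>(y, x). (\<Sum>i=1..n. a i) = 1 \<and> (\<forall>i\<in>{1..n}. x i = y))"

definition nontrivial_PS_solutions ::
    "nat \<Rightarrow> (nat \<Rightarrow> real) \<Rightarrow> real \<Rightarrow> (int \<times> (nat \<Rightarrow> int)) set" where
  "nontrivial_PS_solutions n a \<alpha> = {p \<in> PS_solutions n a \<alpha>. \<not> trivial_solution n a p}"

text \<open>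
  Hausdorff measure and dimension. The cost of a set in a cover is its diameter to the
  power d, where the empty set costs 0 and, for d = 0, every nonempty set costs 1
  (\<open>0 powr 0 = 0\<close> would give singletons cost 0). Covering sets are required to be
  bounded because \<open>diameter\<close> is only meaningful on bounded sets.
\<close>

definition diam_power :: "real \<Rightarrow> 'a::metric_space set \<Rightarrow> ennreal" where
  "diam_power d U =
     (if U = {} then 0 else if d = 0 then 1 else ennreal (diameter U powr d))"

definition hausdorff_premeasure :: "real \<Rightarrow> real \<Rightarrow> 'a::metric_space set \<Rightarrow> ennreal" where
  "hausdorff_premeasure d \<delta> E =
     Inf {(\<Sum>k. diam_power d (U k)) | U :: nat \<Rightarrow> 'a set.
            E \<subseteq> (\<Union>k. U k) \<and> (\<forall>k. bounded (U k) \<and> diameter (U k) \<le> \<delta>)}"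

definition hausdorff_measure :: "real \<Rightarrow> 'a::metric_space set \<Rightarrow> ennreal" where
  "hausdorff_measure d E = (SUP \<delta>\<in>{0<..}. hausdorff_premeasure d \<delta> E)"

definition hausdorff_dim :: "'a::metric_space set \<Rightarrow> ereal" where
  "hausdorff_dim E = Inf {ereal d | d. 0 \<le> d \<and> hausdorff_measure d E = 0}"

end

theory Submission
  imports Defs
begin

text \<open>
  Borel-Cantelli over the index tuples: a solution with \<open>y = \<lfloor>m powr \<alpha>\<rfloor>\<close> and
  \<open>x i = \<lfloor>k i powr \<alpha>\<rfloor>\<close> forces \<open>g \<alpha> = (\<Sum>i=1..n. a i * (k i / m) powr \<alpha>)\<close> to be within
  \<open>O(m powr - s)\<close> of 1, and the set of such \<open>\<alpha>\<close> is short because \<open>g\<close> is steep there.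

  If the coefficients sum to less than 1, then \<open>g\<close> is convex with \<open>g 0 < 1\<close>, so its slope where
  it is close to 1 is bounded below, and the \<open>O(m ^ n)\<close> tuples belonging to \<open>m\<close> contribute
  \<open>O(m powr (n - s * d))\<close> to the \<open>d\<close>-dimensional cost.

  If all \<open>a i \<ge> 1\<close>, then every \<open>k i < m\<close> in a non-trivial solution and the slope of \<open>g\<close> is at
  least of order \<open>h / m\<close> with \<open>h = Min (m - k i)\<close>. Using only \<open>h \<ge> 1\<close> would give the exponent
  \<open>(n + 1) / (s - 1)\<close>; summing \<open>h powr - d\<close> over \<open>h < m\<close> for \<open>d < 1\<close> recovers \<open>(n + 1) / s\<close>.
\<close>

section \<open>Hausdorff measure of limsup sets, and Lebesgue null sets\<close>

text \<open>Convergence half of Borel-Cantelli: every tail of an enumeration of the sets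
  \<open>S p\<close> covers \<open>E\<close>, and the tails of the convergent series bound its cost.
  Since \<open>c\<close> tends to 0 along the enumeration, late sets also meet any bound
  \<open>\<delta>\<close> on the diameters.\<close>

lemma hausdorff_measure_limsup_eq_0:
  fixes S :: "'i \<Rightarrow> 'a::metric_space set" and c :: "'i \<Rightarrow> real"
  assumes "d > 0" and I: "countable I"
    and bdd: "\<And>p. p \<in> I \<Longrightarrow> bounded (S p)"
    and diam: "\<And>p. p \<in> I \<Longrightarrow> diameter (S p) powr d \<le> c p"
    and sum: "c summable_on I"
    and E: "E \<subseteq> {x. infinite {p \<in> I. x \<in> S p}}"
  shows "hausdorff_measure d E = 0"
proof (cases "finite I")
  \<comment> \<open>No point lies in infinitely many sets of a finite family, so \<open>E\<close> is
    empty and is covered by empty sets of cost 0.\<close>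
  case True
  with E have "E = {}" by auto
  have "hausdorff_premeasure d \<delta> E \<le> 0" if "\<delta> > 0" for \<delta>
    unfolding hausdorff_premeasure_def
    by (rule Inf_lower) (use that \<open>E = {}\<close> in \<open>auto intro!: exI[of _ "\<lambda>_. {}"] simp: diam_power_def\<close>)
  then show ?thesis
    by (auto simp: hausdorff_measure_def intro!: antisym SUP_least)
next
  case False
  define e where "e = from_nat_into I"
  have e: "bij_betw e UNIV I"
    unfolding e_def using I False by (rule bij_betw_from_nat_into)
  then have eI: "e j \<in> I" for j
    by (auto simp: bij_betw_def)
  have c0: "c (e j) \<ge> 0" for j
    using diam[OF eI] by (meson order_trans powr_ge_zero)
  have "(\<lambda>j. c (e j)) summable_on UNIV"
    using sum summable_on_reindex_bij_betw[OF e] by blast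
  then have summ: "summable (\<lambda>j. c (e j))"
    using summable_on_UNIV_nonneg_real_iff[of "\<lambda>j. c (e j)"] c0 by simp
  have pre: "hausdorff_premeasure d \<delta> E \<le> 0" if "\<delta> > 0" for \<delta>
  proof (rule ennreal_le_epsilon)
    fix \<epsilon> :: real
    assume "\<epsilon> > 0"
    obtain N1 where N1: "\<And>N. N \<ge> N1 \<Longrightarrow> norm (\<Sum>j. c (e (j + N))) < \<epsilon>"
      using suminf_exist_split[OF \<open>\<epsilon> > 0\<close> summ] by blast
    have "\<forall>\<^sub>F j in sequentially. c (e j) < \<delta> powr d"
      using order_tendstoD(2)[OF summable_LIMSEQ_zero[OF summ]] that by simp
    then obtain N2 where N2: "\<And>j. j \<ge> N2 \<Longrightarrow> c (e j) < \<delta> powr d"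
      by (auto simp: eventually_sequentially)
    define N where "N = max N1 N2"
    define U where "U k = S (e (k + N))" for k
    have Ub: "bounded (U k)" for k
      unfolding U_def by (intro bdd eI)
    have small: "diameter (U k) \<le> \<delta>" for k
    proof (rule ccontr)
      assume "\<not> ?thesis"
      then have "\<delta> powr d \<le> diameter (U k) powr d"
        using that \<open>d > 0\<close> by (intro powr_mono2) auto
      also have "\<dots> \<le> c (e (k + N))"
        unfolding U_def by (intro diam eI)
      also have "\<dots> < \<delta> powr d"
        by (rule N2) (simp add: N_def)
      finally show False by simp
    qed
    have cover: "E \<subseteq> (\<Union>k. U k)"
    proof
      fix x assume "x \<in> E"
      then have inf: "infinite {p \<in> I. x \<in> S p}" using E by auto
      have "{p \<in> I. x \<in> S p} \<subseteq> e ` {j. x \<in> S (e j)}"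
        using e by (force simp: bij_betw_def)
      then have "infinite {j. x \<in> S (e j)}"
        using inf by (meson finite_imageI finite_subset)
      then obtain j where "j \<ge> N" "x \<in> S (e j)"
        by (auto simp: infinite_nat_iff_unbounded_le)
      then show "x \<in> (\<Union>k. U k)"
        by (auto simp: U_def intro!: exI[of _ "j - N"])
    qed
    have "hausdorff_premeasure d \<delta> E \<le> (\<Sum>k. diam_power d (U k))"
      unfolding hausdorff_premeasure_def
      by (rule Inf_lower) (use cover small Ub in \<open>blast\<close>)
    also have "\<dots> \<le> (\<Sum>k. ennreal (c (e (k + N))))"
      by (intro suminf_le)
        (use \<open>d > 0\<close> in \<open>auto simp: diam_power_def U_def intro!: ennreal_leI diam eI\<close>)
    also have "\<dots> = ennreal (\<Sum>k. c (e (k + N)))"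
      by (rule suminf_ennreal2) (use c0 summ in \<open>auto intro: summable_ignore_initial_segment\<close>)
    also have "\<dots> \<le> ennreal \<epsilon>"
      using N1[of N] by (intro ennreal_leI) (auto simp: N_def)
    finally show "hausdorff_premeasure d \<delta> E \<le> 0 + ennreal \<epsilon>" by simp
  qed
  then show ?thesis
    by (auto simp: hausdorff_measure_def intro!: antisym SUP_least)
qed

text \<open>For sets of diameter at most 1 and \<open>d \<le> 1\<close>, the diameter is at most its
  \<open>d\<close>-th power, so a cover of small \<open>d\<close>-cost has small total
  length.\<close>

lemma negligible_if_hausdorff_measure_eq_0:
  fixes E :: "real set"
  assumes "0 < d" "d \<le> 1" and "hausdorff_measure d E = 0"
  shows "negligible E"
  unfolding negligible_outer_le
proof (intro allI impI)
  fix \<epsilon> :: real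
  assume "\<epsilon> > 0"
  have "hausdorff_premeasure d 1 E \<le> hausdorff_measure d E"
    unfolding hausdorff_measure_def by (rule SUP_upper) auto
  then have "hausdorff_premeasure d 1 E < ennreal (\<epsilon> / 2)"
    using assms \<open>\<epsilon> > 0\<close> by simp
  then obtain U :: "nat \<Rightarrow> real set" where U: "E \<subseteq> (\<Union>k. U k)"
    "\<And>k. bounded (U k)" "\<And>k. diameter (U k) \<le> 1"
    "(\<Sum>k. diam_power d (U k)) < ennreal (\<epsilon> / 2)"
    unfolding hausdorff_premeasure_def Inf_less_iff by blast
  have dp: "ennreal (diameter (U k)) \<le> diam_power d (U k)" for k
  proof -
    have "diameter (U k) powr 1 \<le> diameter (U k) powr d"
      using assms U by (intro powr_mono') (auto intro: diameter_ge_0)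
    then show ?thesis
      using assms diameter_ge_0[OF U(2)]
      by (auto simp: diam_power_def intro!: ennreal_leI)
  qed
  \<comment> \<open>The sets \<open>U k\<close> need not be measurable, so each is enclosed in a
    closed ball about one of its points. The ball has length twice the diameter of
    \<open>U k\<close>, which the choice of \<open>\<epsilon> / 2\<close> absorbs.\<close>
  define V where "V k = (if U k = {} then {} else cball (SOME x. x \<in> U k) (diameter (U k)))" for k
  have UV: "U k \<subseteq> V k" for k
  proof
    fix x assume x: "x \<in> U k"
    then have "(SOME x. x \<in> U k) \<in> U k" by (rule someI)
    from diameter_bounded_bound[OF U(2) this x] show "x \<in> V k"
      using x by (auto simp: V_def)
  qed
  have V: "emeasure lebesgue (V k) \<le> 2 * diam_power d (U k)" for k
  proof -
    have cb: "emeasure lebesgue (cball x r) = 2 * ennreal r" if "r \<ge> 0" for x r :: real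
      using that by (simp add: cball_eq_atLeastAtMost flip: ennreal_mult' ennreal_numeral)
    have "emeasure lebesgue (V k) \<le> 2 * ennreal (diameter (U k))"
      unfolding V_def using cb[OF diameter_ge_0[OF U(2)]] by simp
    then show ?thesis
      using mult_left_mono[OF dp, of 2 k] by (rule order_trans) simp
  qed
  have Vm: "V k \<in> sets lebesgue" for k
    by (auto simp: V_def)
  have "emeasure lebesgue (\<Union>k. V k) \<le> (\<Sum>k. emeasure lebesgue (V k))"
    using Vm by (intro emeasure_subadditive_countably) auto
  also have "\<dots> \<le> (\<Sum>k. 2 * diam_power d (U k))"
    by (intro suminf_le V) auto
  also have "\<dots> = 2 * (\<Sum>k. diam_power d (U k))"
    by simp
  also have "\<dots> \<le> 2 * ennreal (\<epsilon> / 2)"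
    using U(4) by (intro mult_left_mono) auto
  also have "\<dots> = ennreal \<epsilon>"
    using \<open>\<epsilon> > 0\<close> by (simp add: numeral_mult_ennreal)
  finally have le: "emeasure lebesgue (\<Union>k. V k) \<le> ennreal \<epsilon>" .
  then have "(\<Union>k. V k) \<in> lmeasurable"
    using Vm by (intro fmeasurableI) (auto simp: less_top[symmetric] top_unique)
  moreover have "measure lebesgue (\<Union>k. V k) \<le> \<epsilon>"
    using le \<open>\<epsilon> > 0\<close> by (simp add: measure_def enn2real_leI)
  ultimately show "\<exists>T. E \<subseteq> T \<and> T \<in> lmeasurable \<and> measure lebesgue T \<le> \<epsilon>"
    using U(1) UV by (intro exI[of _ "\<Union>k. V k"]) blast
qed

section \<open>Elementary inequalities for sums of powers\<close>

text \<open>Discrete comparison with the integral of \<open>x powr - d\<close> from 0 to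
  \<open>N\<close>, which is finite as \<open>d < 1\<close>.\<close>

lemma sum_powr_le:
  fixes d :: real
  assumes "0 < d" "d < 1"
  shows "(\<Sum>h=1..N. real h powr - d) \<le> real N powr (1 - d) / (1 - d)"
proof (induction N)
  case 0
  then show ?case using assms by simp
next
  case (Suc N)
  \<comment> \<open>Each summand is at most an increment of the antiderivative, by the mean value
    theorem. For \<open>N = 0\<close> the antiderivative is not differentiable at the left end, so
    that case is checked directly.\<close>
  have "real (Suc N) powr - d * (1 - d) \<le> real (Suc N) powr (1 - d) - real N powr (1 - d)"
  proof (cases "N = 0")
    case True
    then show ?thesis using assms by simp
  next
    case False
    have "\<exists>z>real N. z < real (Suc N) \<and>
        real (Suc N) powr (1 - d) - real N powr (1 - d) = (real (Suc N) - real N) * ((1 - d) * z powr - d)"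
      by (rule MVT2) (use False in \<open>auto intro!: derivative_eq_intros\<close>)
    then obtain z where z: "z > real N" "z < real (Suc N)"
      "real (Suc N) powr (1 - d) - real N powr (1 - d) = (1 - d) * z powr - d"
      by auto
    have "real (Suc N) powr - d \<le> z powr - d"
      using z assms False by (intro powr_mono2') auto
    then show ?thesis
      using z assms by (simp add: mult.commute mult_left_mono)
  qed
  with Suc.IH assms show ?case
    by (simp add: field_simps)
qed

text \<open>Fixing the coordinate \<open>i\<close> leaves \<open>card A - 1\<close> free ones. This
  reduces a sum over index tuples of a cost depending on a single gap to a one-dimensional
  sum.\<close>

lemma sum_PiE_coordinate:
  fixes f :: "'b \<Rightarrow> 'c::comm_semiring_1"
  assumes "finite A" "finite B" "i \<in> A"
  shows "(\<Sum>g\<in>A \<rightarrow>\<^sub>E B. f (g i)) = of_nat (card B) ^ (card A - 1) * (\<Sum>x\<in>B. f x)"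
proof -
  \<comment> \<open>Padding with factors 1 at the other coordinates makes the summand a product over
    \<open>A\<close>, so that the distributive law applies.\<close>
  have "(\<Sum>g\<in>A \<rightarrow>\<^sub>E B. f (g i)) = (\<Sum>g\<in>A \<rightarrow>\<^sub>E B. \<Prod>j\<in>A. if j = i then f (g j) else 1)"
    using assms by (intro sum.cong) auto
  also have "\<dots> = (\<Prod>j\<in>A. \<Sum>x\<in>B. if j = i then f x else 1)"
    using assms by (subst prod_sum_PiE) auto
  also have "\<dots> = (\<Prod>j\<in>insert i (A - {i}). if j = i then \<Sum>x\<in>B. f x else of_nat (card B))"
    using assms by (intro prod.cong) auto
  also have "\<dots> = (\<Sum>x\<in>B. f x) * (\<Prod>j\<in>A - {i}. of_nat (card B))"
    using assms by (subst prod.insert) (auto intro!: prod.cong)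
  finally show ?thesis
    using assms by (simp add: mult.commute)
qed

text \<open>Replaces a lower bound on the derivative: a power with base at most
  \<open>1 - \<theta>\<close> decays at logarithmic rate
  \<open>- ln (r i) \<ge> 1 - r i \<ge> \<theta>\<close>.\<close>

lemma powr_sum_decrease:
  fixes a r :: "'i \<Rightarrow> real"
  assumes "\<And>i. i \<in> A \<Longrightarrow> 0 \<le> a i" "\<And>i. i \<in> A \<Longrightarrow> 0 < r i" "\<And>i. i \<in> A \<Longrightarrow> r i \<le> 1 - \<theta>"
    and "\<alpha> \<le> \<beta>"
  shows "(\<beta> - \<alpha>) * \<theta> * (\<Sum>i\<in>A. a i * r i powr \<beta>)
           \<le> (\<Sum>i\<in>A. a i * r i powr \<alpha>) - (\<Sum>i\<in>A. a i * r i powr \<beta>)"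
  unfolding sum_distrib_left sum_subtractf[symmetric]
proof (rule sum_mono)
  fix i assume i: "i \<in> A"
  have "\<theta> \<le> - ln (r i)"
    using ln_le_minus_one[of "r i"] assms i by fastforce
  then have "(\<beta> - \<alpha>) * \<theta> \<le> (\<alpha> - \<beta>) * ln (r i)"
    using mult_left_mono[of \<theta> "- ln (r i)" "\<beta> - \<alpha>"] assms(4) by (simp add: algebra_simps)
  also have "1 + \<dots> \<le> r i powr (\<alpha> - \<beta>)"
    using assms(2)[OF i] exp_ge_add_one_self[of "(\<alpha> - \<beta>) * ln (r i)"] by (simp add: powr_def)
  finally have "(\<beta> - \<alpha>) * \<theta> + 1 \<le> r i powr (\<alpha> - \<beta>)" by simp
  then have "((\<beta> - \<alpha>) * \<theta> + 1) * (a i * r i powr \<beta>) \<le> r i powr (\<alpha> - \<beta>) * (a i * r i powr \<beta>)"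
    using assms i by (intro mult_right_mono) auto
  also have "\<dots> = a i * r i powr \<alpha>"
    using assms(2)[OF i] by (simp flip: powr_add)
  finally show "(\<beta> - \<alpha>) * \<theta> * (a i * r i powr \<beta>) \<le> a i * r i powr \<alpha> - a i * r i powr \<beta>"
    by (simp add: algebra_simps)
qed

text \<open>Convexity in the exponent: the chord over \<open>[0, \<alpha>]\<close> is no steeper
  than the chord over \<open>[\<alpha>, \<beta>]\<close>, with denominators cleared. The value at
  exponent 0 is the plain sum of the coefficients.\<close>

lemma powr_sum_increase:
  fixes a r :: "'i \<Rightarrow> real"
  assumes "\<And>i. i \<in> A \<Longrightarrow> 0 \<le> a i" "\<And>i. i \<in> A \<Longrightarrow> 0 < r i" and "0 < \<alpha>" "\<alpha> \<le> \<beta>"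
  shows "(\<beta> - \<alpha>) * ((\<Sum>i\<in>A. a i * r i powr \<alpha>) - (\<Sum>i\<in>A. a i))
           \<le> \<alpha> * ((\<Sum>i\<in>A. a i * r i powr \<beta>) - (\<Sum>i\<in>A. a i * r i powr \<alpha>))"
  unfolding sum_distrib_left sum_subtractf[symmetric]
proof (rule sum_mono)
  fix i assume i: "i \<in> A"
  \<comment> \<open>Weight writing \<open>\<alpha>\<close> as a convex combination of
    \<open>\<beta>\<close> and 0; Young's inequality is applied to \<open>r i powr \<beta>\<close>
    and 1 with weights \<open>L\<close> and \<open>1 - L\<close>.\<close>
  define L where "L = \<alpha> / \<beta>"
  have L: "0 \<le> L" "L \<le> 1" "L * \<beta> = \<alpha>"
    using assms by (auto simp: L_def)
  have "r i powr \<alpha> \<le> (1 - L) + L * r i powr \<beta>"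
    using Youngs_inequality_0[of L "1 - L" "r i powr \<beta>" 1] L assms(2)[OF i]
    by (simp add: powr_powr mult.commute)
  then have "\<beta> * r i powr \<alpha> \<le> \<beta> * ((1 - L) + L * r i powr \<beta>)"
    using assms by (intro mult_left_mono) auto
  also have "\<dots> = (\<beta> - \<alpha>) + \<alpha> * r i powr \<beta>"
    using L(3) by (simp add: algebra_simps flip: mult.assoc)
  finally have "(\<beta> - \<alpha>) * (r i powr \<alpha> - 1) \<le> \<alpha> * (r i powr \<beta> - r i powr \<alpha>)"
    by (simp add: algebra_simps)
  from mult_left_mono[OF this, of "a i"]
  show "(\<beta> - \<alpha>) * (a i * r i powr \<alpha> - a i) \<le> \<alpha> * (a i * r i powr \<beta> - a i * r i powr \<alpha>)"
    using assms(1)[OF i] by (simp add: algebra_simps)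
qed

section \<open>From solutions to windows of exponents\<close>

text \<open>What is left of the equation when the integer parts are dropped: rounding changes the
  left side by at most 1 and the right side by at most the sum of the coefficients.\<close>

definition near_window :: "nat \<Rightarrow> (nat \<Rightarrow> real) \<Rightarrow> real \<Rightarrow> real \<Rightarrow> nat \<times> (nat \<Rightarrow> nat) \<Rightarrow> real set" where
  "near_window n a s t = (\<lambda>(m, k).
     {\<alpha> \<in> {s..t}. \<bar>real m powr \<alpha> - (\<Sum>i=1..n. a i * real (k i) powr \<alpha>)\<bar> \<le> 1 + (\<Sum>i=1..n. a i)})"

text \<open>Solutions are counted through their index tuples: infinitely many solutions must come
  from infinitely many tuples. \<open>restrict\<close> produces the extensional functions that
  \<open>PS_solutions\<close> uses.\<close>

definition floor_powr_tuple :: "nat \<Rightarrow> real \<Rightarrow> nat \<times> (nat \<Rightarrow> nat) \<Rightarrow> int \<times> (nat \<Rightarrow> int)" where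
  "floor_powr_tuple n \<alpha> = (\<lambda>(m, k).
     (\<lfloor>real m powr \<alpha>\<rfloor>, restrict (\<lambda>i. \<lfloor>real (k i) powr \<alpha>\<rfloor>) {1..n}))"

lemma PS_solution_indices:
  assumes a: "\<And>i. i \<in> {1..n} \<Longrightarrow> a i > 0"
    and sol: "p \<in> PS_solutions n a \<alpha>" and \<alpha>: "\<alpha> \<in> {s..t}"
  obtains m k where "m \<ge> 1" "k \<in> {1..n} \<rightarrow>\<^sub>E {1..}"
    "p = floor_powr_tuple n \<alpha> (m, k)" "\<alpha> \<in> near_window n a s t (m, k)"
proof -
  obtain y x where p: "p = (y, x)" by (cases p)
  from sol have y: "y \<in> PS \<alpha>" and x: "x \<in> {1..n} \<rightarrow>\<^sub>E PS \<alpha>"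
    and eq: "real_of_int y = (\<Sum>i=1..n. a i * real_of_int (x i))"
    by (auto simp: PS_solutions_def p)
  from y obtain m where m: "m \<ge> 1" "y = \<lfloor>real m powr \<alpha>\<rfloor>"
    by (auto simp: PS_def)
  have "\<forall>i\<in>{1..n}. \<exists>j\<ge>1. x i = \<lfloor>real j powr \<alpha>\<rfloor>"
    using x by (force simp: PS_def PiE_def Pi_def)
  then obtain k0 where k0: "\<And>i. i \<in> {1..n} \<Longrightarrow> k0 i \<ge> (1::nat) \<and> x i = \<lfloor>real (k0 i) powr \<alpha>\<rfloor>"
    by metis
  define k where "k = restrict k0 {1..n}"
  have k: "k i \<ge> 1" "x i = \<lfloor>real (k i) powr \<alpha>\<rfloor>" if "i \<in> {1..n}" for i
    using k0[OF that] that by (auto simp: k_def)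
  have kE: "k \<in> {1..n} \<rightarrow>\<^sub>E {1..}"
    using k(1) by (auto simp: k_def)
  have px: "p = floor_powr_tuple n \<alpha> (m, k)"
  proof -
    have "x = restrict (\<lambda>i. \<lfloor>real (k i) powr \<alpha>\<rfloor>) {1..n}"
      using x k(2) by (intro ext) (auto simp: restrict_def PiE_def extensional_def)
    then show ?thesis
      by (simp add: p m floor_powr_tuple_def)
  qed
  have lo: "(\<Sum>i=1..n. a i * real_of_int (x i)) \<le> (\<Sum>i=1..n. a i * real (k i) powr \<alpha>)"
    using a k(2) by (intro sum_mono mult_left_mono) (auto simp: less_imp_le)
  have "(\<Sum>i=1..n. a i * real (k i) powr \<alpha>) \<le> (\<Sum>i=1..n. a i * (real_of_int (x i) + 1))"
    using a k(2) by (intro sum_mono mult_left_mono) (auto simp: less_imp_le)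
  also have "\<dots> = real_of_int y + (\<Sum>i=1..n. a i)"
    by (simp add: eq sum.distrib algebra_simps)
  finally have hi: "(\<Sum>i=1..n. a i * real (k i) powr \<alpha>) \<le> real_of_int y + (\<Sum>i=1..n. a i)" .
  have "0 \<le> (\<Sum>i=1..n. a i)"
    using a by (intro sum_nonneg) (auto simp: less_imp_le)
  moreover have "real_of_int y \<le> real m powr \<alpha>" "real m powr \<alpha> \<le> real_of_int y + 1"
    by (simp_all add: m(2) less_imp_le)
  ultimately have "\<alpha> \<in> near_window n a s t (m, k)"
    using lo hi \<alpha> eq unfolding near_window_def by (simp add: abs_le_iff)
  with m(1) kE px show ?thesis by (rule that)
qed

text \<open>Division by \<open>real m powr \<alpha>\<close>. As \<open>m \<ge> 1\<close> and
  \<open>\<alpha> \<ge> s\<close>, the error exponent can be taken as \<open>- s\<close> uniformly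
  over the window.\<close>

lemma near_window_scaled:
  assumes a: "\<And>i. i \<in> {1..n} \<Longrightarrow> a i > 0" and "m \<ge> 1"
    and \<alpha>: "\<alpha> \<in> near_window n a s t (m, k)"
  shows "\<bar>(\<Sum>i=1..n. a i * (real (k i) / real m) powr \<alpha>) - 1\<bar> \<le> (1 + (\<Sum>i=1..n. a i)) * real m powr - s"
proof -
  define C where "C = 1 + (\<Sum>i=1..n. a i)"
  have "C \<ge> 0"
    unfolding C_def using a by (intro add_nonneg_nonneg sum_nonneg) (auto simp: less_imp_le)
  define g where "g = (\<Sum>i=1..n. a i * (real (k i) / real m) powr \<alpha>)"
  have pos: "real m powr \<alpha> > 0" using \<open>m \<ge> 1\<close> by simp
  have "g = (\<Sum>i=1..n. a i * real (k i) powr \<alpha>) / real m powr \<alpha>"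
    unfolding g_def sum_divide_distrib by (intro sum.cong) (simp_all add: powr_divide)
  then have "g - 1 = - ((real m powr \<alpha> - (\<Sum>i=1..n. a i * real (k i) powr \<alpha>)) / real m powr \<alpha>)"
    using pos by (simp add: diff_divide_distrib)
  then have "\<bar>g - 1\<bar> = \<bar>real m powr \<alpha> - (\<Sum>i=1..n. a i * real (k i) powr \<alpha>)\<bar> / real m powr \<alpha>"
    using pos by simp
  also have "\<dots> \<le> C / real m powr \<alpha>"
    using \<alpha> pos by (intro divide_right_mono) (auto simp: near_window_def C_def)
  also have "\<dots> = C * real m powr - \<alpha>"
    by (simp add: powr_minus divide_inverse)
  also have "\<dots> \<le> C * real m powr - s"
    using \<open>C \<ge> 0\<close> \<open>m \<ge> 1\<close> \<alpha> by (intro mult_left_mono powr_mono) (auto simp: near_window_def)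
  finally show ?thesis unfolding g_def C_def .
qed

lemma eventually_mult_powr_le:
  fixes C s \<eta> :: real
  assumes "s > 0" "\<eta> > 0"
  shows "\<exists>m0\<ge>1. \<forall>m\<ge>m0. C * real m powr - s \<le> \<eta>"
proof -
  have "(\<lambda>m. C * real m powr - s) \<longlonglongrightarrow> C * 0"
    using assms by (intro tendsto_mult tendsto_const tendsto_neg_powr filterlim_real_sequentially) auto
  then have "\<forall>\<^sub>F m in sequentially. C * real m powr - s < \<eta>"
    using assms by (intro order_tendstoD(2)[of _ "C * 0"]) auto
  then obtain m0 where "\<And>m. m \<ge> m0 \<Longrightarrow> C * real m powr - s < \<eta>"
    by (auto simp: eventually_sequentially)
  then show ?thesis
    by (intro exI[of _ "max 1 m0"]) (auto simp: less_imp_le)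
qed

text \<open>Common frame for both cases of the theorem. \<open>F m\<close> holds the candidate
  tuples \<open>k\<close> for a given \<open>m\<close>, \<open>D m k\<close> bounds the length of
  the window, and \<open>e\<close> is the decay exponent of the total cost belonging to
  \<open>m\<close>; \<open>e < -1\<close> makes the sum over \<open>m\<close> converge.\<close>

lemma hausdorff_measure_infinite_solutions_eq_0:
  fixes F :: "nat \<Rightarrow> (nat \<Rightarrow> nat) set" and D :: "nat \<Rightarrow> (nat \<Rightarrow> nat) \<Rightarrow> real"
  assumes "d > 0" "m0 \<ge> 1" "e < -1"
    and F: "\<And>m. finite (F m)"
    and param: "\<And>\<alpha> p. \<alpha> \<in> {s..t} \<Longrightarrow> p \<in> nontrivial_PS_solutions n a \<alpha> \<Longrightarrow>
       \<exists>m\<ge>1. \<exists>k\<in>F m. p = floor_powr_tuple n \<alpha> (m, k) \<and> \<alpha> \<in> near_window n a s t (m, k)"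
    and D0: "\<And>m k. m \<ge> m0 \<Longrightarrow> k \<in> F m \<Longrightarrow> D m k \<ge> 0"
    and width: "\<And>m k \<alpha> \<beta>. m \<ge> m0 \<Longrightarrow> k \<in> F m \<Longrightarrow> \<alpha> \<in> near_window n a s t (m, k) \<Longrightarrow>
       \<beta> \<in> near_window n a s t (m, k) \<Longrightarrow> \<alpha> \<le> \<beta> \<Longrightarrow> \<beta> - \<alpha> \<le> D m k"
    and sum_le: "\<And>m. m \<ge> m0 \<Longrightarrow> (\<Sum>k\<in>F m. D m k powr d) \<le> B * real m powr e"
  shows "hausdorff_measure d {\<alpha> \<in> {s..t}. infinite (nontrivial_PS_solutions n a \<alpha>)} = 0"
proof (rule hausdorff_measure_limsup_eq_0)
  let ?W = "near_window n a s t"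
  let ?I = "Sigma {m0..} F"
  show "d > 0" by fact
  show "countable ?I"
    using F by (intro countable_SIGMA) (auto intro: countable_finite)
  show bdd: "bounded (?W p)" for p
    by (rule bounded_subset[of "{s..t}"]) (auto simp: near_window_def split: prod.split)
  show "diameter (?W p) powr d \<le> (\<lambda>(m, k). D m k powr d) p" if pI: "p \<in> ?I" for p
  proof -
    obtain m k where p: "p = (m, k)" "m \<ge> m0" "k \<in> F m" using pI by auto
    have "diameter (?W (m, k)) \<le> D m k"
    proof (rule diameter_le)
      show "norm (\<alpha> - \<beta>) \<le> D m k" if "\<alpha> \<in> ?W (m, k)" "\<beta> \<in> ?W (m, k)" for \<alpha> \<beta>
        using width[OF p(2,3) that] width[OF p(2,3) that(2,1)] by (cases "\<alpha> \<le> \<beta>") auto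
    qed (use D0 p in auto)
    then show ?thesis
      using \<open>d > 0\<close> diameter_ge_0[OF bdd] by (auto simp: p intro!: powr_mono2)
  qed
  show "(\<lambda>(m, k). D m k powr d) summable_on ?I"
  proof (rule summable_on_SigmaI)
    show "((\<lambda>k. case (m, k) of (m, k) \<Rightarrow> D m k powr d) has_sum (\<Sum>k\<in>F m. D m k powr d)) (F m)" for m
      using has_sum_finite[OF F, of "\<lambda>k. D m k powr d" m] by simp
    have "summable (\<lambda>m. B * real m powr e)"
      using \<open>e < -1\<close> by (intro summable_mult) (simp add: summable_real_powr_iff)
    then have "summable (\<lambda>m. if m \<ge> m0 then \<Sum>k\<in>F m. D m k powr d else 0)"
      by (rule summable_comparison_test_ev[rotated])
        (use sum_le in \<open>auto simp: eventually_sequentially sum_nonneg intro!: exI[of _ m0]\<close>)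
    then have "(\<lambda>m. if m \<ge> m0 then \<Sum>k\<in>F m. D m k powr d else 0) summable_on UNIV"
      by (subst summable_on_UNIV_nonneg_real_iff) (auto simp: sum_nonneg)
    then show "(\<lambda>m. \<Sum>k\<in>F m. D m k powr d) summable_on {m0..}"
      by (subst (asm) summable_on_cong_neutral[where T = "{m0..}"
            and g = "\<lambda>m. \<Sum>k\<in>F m. D m k powr d"]) auto
  qed auto
  show "{\<alpha> \<in> {s..t}. infinite (nontrivial_PS_solutions n a \<alpha>)} \<subseteq> {\<alpha>. infinite {p \<in> ?I. \<alpha> \<in> ?W p}}"
  proof clarsimp
    fix \<alpha> assume \<alpha>: "s \<le> \<alpha>" "\<alpha> \<le> t" and inf: "infinite (nontrivial_PS_solutions n a \<alpha>)"
      and fin: "finite {p \<in> ?I. \<alpha> \<in> ?W p}"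
    \<comment> \<open>Below \<open>m0\<close> no length bound is available, but there are only
      finitely many such tuples, so adding them keeps the set finite.\<close>
    have "finite (Sigma {..<m0} F)" using F by auto
    with fin have "finite ({p \<in> ?I. \<alpha> \<in> ?W p} \<union> Sigma {..<m0} F)" by blast
    moreover have "nontrivial_PS_solutions n a \<alpha> \<subseteq>
        floor_powr_tuple n \<alpha> ` ({p \<in> ?I. \<alpha> \<in> ?W p} \<union> Sigma {..<m0} F)"
    proof
      fix p assume "p \<in> nontrivial_PS_solutions n a \<alpha>"
      with param[of \<alpha> p] \<alpha> obtain m k where "k \<in> F m" "p = floor_powr_tuple n \<alpha> (m, k)"
        "\<alpha> \<in> ?W (m, k)" by auto
      then show "p \<in> floor_powr_tuple n \<alpha> ` ({p \<in> ?I. \<alpha> \<in> ?W p} \<union> Sigma {..<m0} F)"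
        by (intro image_eqI[of _ _ "(m, k)"]) (auto simp: not_less)
    qed
    ultimately show False
      using inf by (meson finite_imageI finite_subset)
  qed
qed

section \<open>All coefficients at least 1\<close>

lemma PS_ge_1:
  assumes "v \<in> PS \<alpha>" "\<alpha> \<ge> 0"
  shows "v \<ge> 1"
  using assms by (auto simp: PS_def le_floor_iff intro!: ge_one_powr_ge_zero)

text \<open>If \<open>x i \<ge> y\<close>, the term \<open>a i * x i\<close> alone already reaches
  \<open>y\<close>, so there can be no further terms, all of which would be positive. Then
  \<open>n = 1\<close> and \<open>a i = 1\<close>, and the solution is trivial.\<close>

lemma nontrivial_solution_less:
  assumes a: "\<And>i. i \<in> {1..n} \<Longrightarrow> a i \<ge> 1" and "\<alpha> \<ge> 0"
    and sol: "(y, x) \<in> nontrivial_PS_solutions n a \<alpha>" and i: "i \<in> {1..n}"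
  shows "x i < y"
proof (rule ccontr)
  assume "\<not> ?thesis"
  then have yx: "real_of_int y \<le> real_of_int (x i)" by simp
  have x: "x j \<ge> 1" if "j \<in> {1..n}" for j
    using sol that \<open>\<alpha> \<ge> 0\<close>
    by (intro PS_ge_1) (auto simp: nontrivial_PS_solutions_def PS_solutions_def)
  have eq: "real_of_int y = a i * real_of_int (x i) + (\<Sum>j\<in>{1..n}-{i}. a j * real_of_int (x j))"
    using sol i by (simp add: nontrivial_PS_solutions_def PS_solutions_def sum.remove)
  have pos: "a j * real_of_int (x j) > 0" if "j \<in> {1..n}" for j
    using a[OF that] x[OF that] by (intro mult_pos_pos) auto
  have ge: "real_of_int (x i) \<le> a i * real_of_int (x i)"
    using mult_right_mono[OF a[OF i], of "real_of_int (x i)"] x[OF i] by simp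
  have empty: "{1..n} - {i} = {}"
  proof (rule ccontr)
    assume "\<not> ?thesis"
    then have "(\<Sum>j\<in>{1..n}-{i}. a j * real_of_int (x j)) > 0"
      by (intro sum_pos pos) auto
    with yx eq ge show False by linarith
  qed
  then have all: "{1..n} = {i}" using i by blast
  have y: "real_of_int y = a i * real_of_int (x i)" using eq unfolding empty by simp
  with yx ge have "(a i - 1) * real_of_int (x i) = 0"
    by (simp add: algebra_simps)
  with x[OF i] have "a i = 1" by auto
  moreover from this y have "y = x i" by simp
  ultimately have "trivial_solution n a (y, x)"
    unfolding trivial_solution_def all by simp
  with sol show False by (simp add: nontrivial_PS_solutions_def)
qed

text \<open>\<open>powr_sum_decrease\<close> with \<open>\<theta> = h / m\<close>, \<open>h\<close>
  the smallest gap \<open>m - k i\<close>, bounds the window length by a multiple of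
  \<open>m powr (1 - s) / h\<close>. Summing \<open>h powr - d\<close> over the tuples costs a
  multiple of \<open>m powr (n - 1) * m powr (1 - d)\<close>.\<close>

lemma hausdorff_measure_solutions_ge_1:
  fixes s t d :: real
  assumes n: "n \<ge> 1" and a: "\<And>i. i \<in> {1..n} \<Longrightarrow> a i \<ge> 1"
    and s: "s > 0" and d: "(real n + 1) / s < d" "d < 1"
  shows "hausdorff_measure d {\<alpha> \<in> {s..t}. infinite (nontrivial_PS_solutions n a \<alpha>)} = 0"
proof -
  define C where "C = 1 + (\<Sum>i=1..n. a i)"
  have a0: "a i > 0" if "i \<in> {1..n}" for i using a[OF that] by simp
  have C: "C \<ge> 0"
    unfolding C_def using a0 by (intro add_nonneg_nonneg sum_nonneg) (auto simp: less_imp_le)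
  have "d > 0" using d s by (smt (verit) divide_nonneg_pos of_nat_0_le_iff)
  \<comment> \<open>This \<open>m0\<close> ensures \<open>g \<ge> 1 / 2\<close> on the windows with
    \<open>m \<ge> m0\<close>.\<close>
  obtain m0 where m0: "m0 \<ge> 1" "\<And>m. m \<ge> m0 \<Longrightarrow> C * real m powr - s \<le> 1 / 2"
    using eventually_mult_powr_le[of s "1/2" C] s by auto
  define F where "F m = {1..n} \<rightarrow>\<^sub>E {1..<m}" for m :: nat
  define h where "h m k = Min ((\<lambda>i. m - k i) ` {1..n})" for m :: nat and k :: "nat \<Rightarrow> nat"
  have h: "\<exists>i\<in>{1..n}. h m k = m - k i" "\<And>i. i \<in> {1..n} \<Longrightarrow> h m k \<le> m - k i" for m k
  proof -
    have "h m k \<in> (\<lambda>i. m - k i) ` {1..n}"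
      unfolding h_def using n by (intro Min_in) auto
    then show "\<exists>i\<in>{1..n}. h m k = m - k i" by auto
    show "h m k \<le> m - k i" if "i \<in> {1..n}" for i
      unfolding h_def using that by (intro Min_le) auto
  qed
  \<comment> \<open>The factor 4 is 2 for the errors at the two ends of the window, times 2 for the
    lower bound \<open>1 / 2\<close> on \<open>g\<close>.\<close>
  define D where "D m k = 4 * C * real m powr (1 - s) / real (h m k)" for m k
  show ?thesis
  proof (rule hausdorff_measure_infinite_solutions_eq_0)
    show "d > 0" "m0 \<ge> 1" by fact+
    \<comment> \<open>The hypothesis on \<open>d\<close> multiplied by \<open>s\<close>: this is
      where the exponent \<open>(n + 1) / s\<close> arises.\<close>
    show "real n - s * d < -1" using d s by (simp add: field_simps)
    show "finite (F m)" for m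
      by (auto simp: F_def intro!: finite_PiE)
    show "D m k \<ge> 0" for m k
      using C by (simp add: D_def)
  next
    fix \<alpha> p assume \<alpha>: "\<alpha> \<in> {s..t}" and p: "p \<in> nontrivial_PS_solutions n a \<alpha>"
    then have "p \<in> PS_solutions n a \<alpha>" by (simp add: nontrivial_PS_solutions_def)
    from PS_solution_indices[OF a0 this \<alpha>]
    obtain m k where mk: "m \<ge> 1" "k \<in> {1..n} \<rightarrow>\<^sub>E {1..}"
      "p = floor_powr_tuple n \<alpha> (m, k)" "\<alpha> \<in> near_window n a s t (m, k)" by metis
    \<comment> \<open>A base \<open>k i \<ge> m\<close> would give \<open>x i \<ge> y\<close> by
      monotonicity, so every gap is at least 1.\<close>
    have "k i < m" if i: "i \<in> {1..n}" for i
    proof (rule ccontr)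
      assume "\<not> ?thesis"
      then have "\<lfloor>real m powr \<alpha>\<rfloor> \<le> \<lfloor>real (k i) powr \<alpha>\<rfloor>"
        using \<alpha> s by (intro floor_mono powr_mono2) auto
      moreover have "\<lfloor>real (k i) powr \<alpha>\<rfloor> < \<lfloor>real m powr \<alpha>\<rfloor>"
        using nontrivial_solution_less[OF a _ p[unfolded mk(3) floor_powr_tuple_def prod.case] i] i \<alpha> s
        by simp
      ultimately show False by simp
    qed
    with mk(2) have "k \<in> F m" by (auto simp: F_def PiE_def Pi_def)
    with mk show "\<exists>m\<ge>1. \<exists>k\<in>F m. p = floor_powr_tuple n \<alpha> (m, k) \<and> \<alpha> \<in> near_window n a s t (m, k)"
      by blast
  next
    fix m k \<alpha> \<beta>
    assume m: "m \<ge> m0" and k: "k \<in> F m" and \<alpha>: "\<alpha> \<in> near_window n a s t (m, k)"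
      and \<beta>: "\<beta> \<in> near_window n a s t (m, k)" and le: "\<alpha> \<le> \<beta>"
    define g where "g x = (\<Sum>i=1..n. a i * (real (k i) / real m) powr x)" for x
    define H where "H = real (h m k)"
    have m1: "m \<ge> 1" using m m0 by simp
    have km: "1 \<le> k i" "k i < m" if "i \<in> {1..n}" for i
      using k that by (auto simp: F_def PiE_def Pi_def)
    have H: "H > 0"
      using h(1)[of m k] km unfolding H_def by auto
    have g: "\<bar>g \<alpha> - 1\<bar> \<le> C * real m powr - s" "\<bar>g \<beta> - 1\<bar> \<le> C * real m powr - s"
      using near_window_scaled[OF a0 m1 \<alpha>] near_window_scaled[OF a0 m1 \<beta>]
      by (simp_all add: g_def C_def)
    have g\<beta>: "g \<beta> \<ge> 1 / 2" using g(2) m0(2)[OF m] by linarith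
    have "(\<beta> - \<alpha>) * (H / real m) * g \<beta> \<le> g \<alpha> - g \<beta>"
      unfolding g_def
    proof (rule powr_sum_decrease)
      fix i assume i: "i \<in> {1..n}"
      show "0 \<le> a i" using a0[OF i] by simp
      show "0 < real (k i) / real m" using km[OF i] by simp
      have "H \<le> real m - real (k i)"
        using h(2)[OF i, of m k] km[OF i] unfolding H_def by linarith
      then show "real (k i) / real m \<le> 1 - H / real m"
        using m1 by (simp add: field_simps)
    qed fact
    moreover have "(\<beta> - \<alpha>) * (H / real m) * (1 / 2) \<le> (\<beta> - \<alpha>) * (H / real m) * g \<beta>"
      using g\<beta> le H by (intro mult_left_mono) auto
    ultimately have "(\<beta> - \<alpha>) * (H / real m) * (1 / 2) \<le> 2 * (C * real m powr - s)"
      using g by linarith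
    then have "\<beta> - \<alpha> \<le> 4 * C * (real m * real m powr - s) / H"
      using H m1 by (simp add: field_simps)
    also have "real m * real m powr - s = real m powr (1 - s)"
      using m1 by (simp add: powr_mult_base)
    finally show "\<beta> - \<alpha> \<le> D m k" by (simp add: D_def H_def)
  next
    fix m assume m: "m \<ge> m0"
    have m1: "m \<ge> 1" using m m0 by simp
    define P where "P = (4 * C) powr d * real m powr ((1 - s) * d)"
    have "P \<ge> 0" by (simp add: P_def)
    \<comment> \<open>The smallest gap is attained at some coordinate, so \<open>h powr - d\<close>
      is at most the sum over all coordinates. This costs a factor \<open>n\<close> but leaves
      summands depending on one coordinate each.\<close>
    have "(\<Sum>k\<in>F m. D m k powr d) \<le> (\<Sum>k\<in>F m. P * (\<Sum>i=1..n. real (m - k i) powr - d))"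
    proof (rule sum_mono)
      fix k assume "k \<in> F m"
      have "D m k powr d = P * real (h m k) powr - d"
        using C by (simp add: D_def P_def powr_divide powr_mult powr_powr powr_minus_divide)
      also have "\<dots> \<le> P * (\<Sum>i=1..n. real (m - k i) powr - d)"
      proof (rule mult_left_mono)
        obtain i where i: "i \<in> {1..n}" "h m k = m - k i" using h(1) by blast
        then show "real (h m k) powr - d \<le> (\<Sum>i=1..n. real (m - k i) powr - d)"
          using member_le_sum[of i "{1..n}" "\<lambda>i. real (m - k i) powr - d"] by auto
      qed fact
      finally show "D m k powr d \<le> P * (\<Sum>i=1..n. real (m - k i) powr - d)" .
    qed
    also have "\<dots> = P * (\<Sum>i=1..n. \<Sum>k\<in>F m. real (m - k i) powr - d)"
      by (subst sum.swap) (simp add: sum_distrib_left)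
    also have "\<dots> = P * (\<Sum>i=1..n. real (m - 1) ^ (n - 1) * (\<Sum>x\<in>{1..<m}. real (m - x) powr - d))"
      unfolding F_def using sum_PiE_coordinate[of "{1..n}" "{1..<m}" _ "\<lambda>x. real (m - x) powr - d"]
      by simp
    \<comment> \<open>The reflection taking \<open>x\<close> to \<open>m - x\<close> makes the gap
      the summation variable.\<close>
    also have "(\<Sum>x\<in>{1..<m}. real (m - x) powr - d) = (\<Sum>x=1..m - 1. real x powr - d)"
      by (rule sum.reindex_bij_witness[of _ "\<lambda>x. m - x" "\<lambda>x. m - x"]) auto
    also have "P * (\<Sum>i=1..n. real (m - 1) ^ (n - 1) * (\<Sum>x=1..m - 1. real x powr - d)) =
        P * (real n * (real (m - 1) ^ (n - 1) * (\<Sum>x=1..m - 1. real x powr - d)))"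
      by simp
    also have "\<dots> \<le> P * (real n * (real m powr (real n - 1) * (real m powr (1 - d) / (1 - d))))"
    proof (intro mult_left_mono mult_mono)
      have "real (m - 1) ^ (n - 1) \<le> real m ^ (n - 1)" by (intro power_mono) auto
      also have "\<dots> = real m powr (real n - 1)"
        using m1 n by (simp add: of_nat_diff flip: powr_realpow)
      finally show "real (m - 1) ^ (n - 1) \<le> real m powr (real n - 1)" .
      have "(\<Sum>x=1..m - 1. real x powr - d) \<le> real (m - 1) powr (1 - d) / (1 - d)"
        by (rule sum_powr_le) fact+
      also have "\<dots> \<le> real m powr (1 - d) / (1 - d)"
        using d by (intro divide_right_mono powr_mono2) auto
      finally show "(\<Sum>x=1..m - 1. real x powr - d) \<le> real m powr (1 - d) / (1 - d)" .
    qed (use \<open>P \<ge> 0\<close> in \<open>auto intro: sum_nonneg\<close>)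
    also have "\<dots> = (4 * C) powr d * real n / (1 - d) *
        (real m powr ((1 - s) * d) * real m powr (real n - 1) * real m powr (1 - d))"
      by (simp add: P_def)
    \<comment> \<open>The \<open>+ d\<close> caused by the factor \<open>m\<close> lost in the slope
      cancels the \<open>- d\<close> gained by summing over the gaps.\<close>
    also have "real m powr ((1 - s) * d) * real m powr (real n - 1) * real m powr (1 - d)
        = real m powr (real n - s * d)"
      by (simp add: algebra_simps flip: powr_add)
    finally show "(\<Sum>k\<in>F m. D m k powr d) \<le> (4 * C) powr d * real n / (1 - d) * real m powr (real n - s * d)" .
  qed
qed

section \<open>Coefficient sum below 1\<close>

text \<open>\<open>g\<close> equals \<open>A < 1\<close> at exponent 0 and is close to 1 on the
  window, so by convexity it rises there at a rate of at least \<open>(1 - A) / (2 * t)\<close>, and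
  the window length is at most a constant times \<open>m powr - s\<close>. The ratios
  \<open>k i / m\<close> may exceed 1 here, whence the range \<open>{1..K * m}\<close>.\<close>

lemma hausdorff_measure_solutions_sum_less_1:
  fixes s t d :: real
  assumes a: "\<And>i. i \<in> {1..n} \<Longrightarrow> a i > 0" and sum1: "(\<Sum>i=1..n. a i) < 1"
    and s: "s \<ge> 1" and d: "(real n + 1) / s < d"
  shows "hausdorff_measure d {\<alpha> \<in> {s..t}. infinite (nontrivial_PS_solutions n a \<alpha>)} = 0"
proof -
  define A where "A = (\<Sum>i=1..n. a i)"
  define C where "C = 1 + A"
  have A: "0 \<le> A" "A < 1"
    unfolding A_def using a sum1 by (auto intro!: sum_nonneg simp: less_imp_le)
  then have C: "C \<ge> 0" by (simp add: C_def)
  have "d > 0" using d s by (smt (verit) divide_nonneg_pos of_nat_0_le_iff)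
  \<comment> \<open>From \<open>m0\<close> on, \<open>g\<close> is at least the midpoint of
    \<open>A\<close> and 1 on the window.\<close>
  obtain m0 where m0: "m0 \<ge> 1" "\<And>m. m \<ge> m0 \<Longrightarrow> C * real m powr - s \<le> (1 - A) / 2"
    using eventually_mult_powr_le[of s "(1 - A) / 2" C] s A by auto
  \<comment> \<open>A single term satisfies
    \<open>a i * (k i / m) powr \<alpha> \<le> 1 + C\<close>, which bounds \<open>k i / m\<close> by
    \<open>K\<close>. The added 1 gives \<open>K \<ge> 1\<close>, hence
    \<open>K \<le> K powr \<alpha>\<close>.\<close>
  define K where "K = (\<Sum>i=1..n. nat \<lceil>(1 + C) / a i\<rceil>) + 1"
  have K: "(1 + C) / a i \<le> real K" if "i \<in> {1..n}" for i
  proof -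
    have "nat \<lceil>(1 + C) / a i\<rceil> \<le> (\<Sum>i=1..n. nat \<lceil>(1 + C) / a i\<rceil>)"
      using that by (intro member_le_sum) auto
    then show ?thesis unfolding K_def by linarith
  qed
  have "real K \<ge> 1" by (simp add: K_def sum_nonneg)
  define F where "F m = {1..n} \<rightarrow>\<^sub>E {1..K * m}" for m :: nat
  \<comment> \<open>The absolute value keeps \<open>c \<ge> 0\<close> even when \<open>t\<close> is
    negative and all windows are empty.\<close>
  define c where "c = 4 * C * \<bar>t\<bar> / (1 - A)"
  have "c \<ge> 0" unfolding c_def using A C by simp
  define D :: "nat \<Rightarrow> (nat \<Rightarrow> nat) \<Rightarrow> real" where "D m k = c * real m powr - s" for m k
  show ?thesis
  proof (rule hausdorff_measure_infinite_solutions_eq_0)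
    show "d > 0" "m0 \<ge> 1" by fact+
    show "real n - s * d < -1" using d s by (simp add: field_simps)
    show "finite (F m)" for m
      by (auto simp: F_def intro!: finite_PiE)
    show "D m k \<ge> 0" for m k
      using \<open>c \<ge> 0\<close> by (simp add: D_def)
  next
    fix \<alpha> p assume \<alpha>: "\<alpha> \<in> {s..t}" and p: "p \<in> nontrivial_PS_solutions n a \<alpha>"
    then have "p \<in> PS_solutions n a \<alpha>" by (simp add: nontrivial_PS_solutions_def)
    from PS_solution_indices[OF a this \<alpha>]
    obtain m k where mk: "m \<ge> 1" "k \<in> {1..n} \<rightarrow>\<^sub>E {1..}"
      "p = floor_powr_tuple n \<alpha> (m, k)" "\<alpha> \<in> near_window n a s t (m, k)" by metis
    have "k i \<le> K * m" if i: "i \<in> {1..n}" for i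
    proof -
      define r where "r = real (k i) / real m"
      have "a i * r powr \<alpha> \<le> (\<Sum>i=1..n. a i * (real (k i) / real m) powr \<alpha>)"
        unfolding r_def
        by (rule member_le_sum[OF i]) (use a in \<open>auto intro!: mult_nonneg_nonneg simp: less_imp_le\<close>)
      also have "\<dots> \<le> 1 + C * real m powr - s"
        using near_window_scaled[OF a mk(1,4)] by (simp add: C_def A_def)
      also have "\<dots> \<le> 1 + C * 1"
        using C mk(1) s powr_mono[of "- s" 0 "real m"] by (intro add_left_mono mult_left_mono) auto
      finally have "r powr \<alpha> \<le> (1 + C) / a i"
        using a[OF i] by (simp add: field_simps)
      also have "\<dots> \<le> real K" by (rule K[OF i])
      also have "\<dots> \<le> real K powr \<alpha>"
        using powr_mono[of 1 \<alpha> "real K"] \<alpha> s \<open>real K \<ge> 1\<close> by simp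
      finally have "r \<le> real K"
        using \<alpha> s powr_less_mono2[of \<alpha> "real K" r] by (force simp: not_le[symmetric])
      then have "real (k i) \<le> real (K * m)"
        using mk(1) by (simp add: r_def field_simps)
      then show ?thesis by (simp only: of_nat_le_iff)
    qed
    with mk(2) have "k \<in> F m" by (auto simp: F_def PiE_def Pi_def)
    with mk show "\<exists>m\<ge>1. \<exists>k\<in>F m. p = floor_powr_tuple n \<alpha> (m, k) \<and> \<alpha> \<in> near_window n a s t (m, k)"
      by blast
  next
    fix m k \<alpha> \<beta>
    assume m: "m \<ge> m0" and k: "k \<in> F m" and \<alpha>: "\<alpha> \<in> near_window n a s t (m, k)"
      and \<beta>: "\<beta> \<in> near_window n a s t (m, k)" and le: "\<alpha> \<le> \<beta>"
    define g where "g x = (\<Sum>i=1..n. a i * (real (k i) / real m) powr x)" for x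
    define \<eta> where "\<eta> = C * real m powr - s"
    have m1: "m \<ge> 1" using m m0 by simp
    have st: "s \<le> \<alpha>" "\<alpha> \<le> t" using \<alpha> by (auto simp: near_window_def)
    have g: "\<bar>g \<alpha> - 1\<bar> \<le> \<eta>" "\<bar>g \<beta> - 1\<bar> \<le> \<eta>"
      using near_window_scaled[OF a m1 \<alpha>] near_window_scaled[OF a m1 \<beta>]
      by (simp_all add: g_def C_def A_def \<eta>_def)
    have "\<eta> \<ge> 0" using C by (simp add: \<eta>_def)
    have g\<alpha>: "(1 - A) / 2 \<le> g \<alpha> - A" using g(1) m0(2)[OF m] unfolding \<eta>_def by argo
    have "(\<beta> - \<alpha>) * ((1 - A) / 2) \<le> (\<beta> - \<alpha>) * (g \<alpha> - A)"
      using g\<alpha> le by (intro mult_left_mono) auto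
    also have "\<dots> \<le> \<alpha> * (g \<beta> - g \<alpha>)"
      unfolding g_def A_def
    proof (rule powr_sum_increase)
      show "0 < real (k i) / real m" if "i \<in> {1..n}" for i
        using k that m1 by (auto simp: F_def PiE_def Pi_def Suc_le_eq)
    qed (use a st s le in \<open>auto simp: less_imp_le\<close>)
    also have "\<dots> \<le> \<alpha> * (2 * \<eta>)"
      using g st s by (intro mult_left_mono) auto
    also have "\<dots> \<le> \<bar>t\<bar> * (2 * \<eta>)"
      using st \<open>\<eta> \<ge> 0\<close> by (intro mult_right_mono) auto
    finally show "\<beta> - \<alpha> \<le> D m k"
      using A by (simp add: D_def c_def \<eta>_def field_simps)
  next
    fix m assume m: "m \<ge> m0"
    have m1: "m \<ge> 1" using m m0 by simp
    have "(\<Sum>k\<in>F m. D m k powr d) = real (K * m) ^ n * (c powr d * real m powr (- s * d))"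
      using \<open>c \<ge> 0\<close> by (simp add: D_def F_def card_PiE powr_mult powr_powr)
    also have "\<dots> = c powr d * real K ^ n * (real m powr real n * real m powr (- s * d))"
      using m1 by (simp add: power_mult_distrib powr_realpow)
    also have "real m powr real n * real m powr (- s * d) = real m powr (real n - s * d)"
      by (simp flip: powr_add)
    finally show "(\<Sum>k\<in>F m. D m k powr d) \<le> c powr d * real K ^ n * real m powr (real n - s * d)"
      by simp
  qed
qed

section \<open>Dimension bound and almost everywhere statement\<close>

theorem theorem2p1:
  fixes n :: nat and a :: "nat \<Rightarrow> real"
  assumes "n \<ge> 1"
    and "\<forall>i\<in>{1..n}. a i > 0"
    and "(\<forall>i\<in>{1..n}. a i \<ge> 1) \<or> (\<Sum>i=1..n. a i) < 1"
  shows "(\<forall>s t :: real. real n + 1 < s \<longrightarrow> s < t \<longrightarrow>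
            hausdorff_dim {\<alpha> \<in> {s..t}. infinite (nontrivial_PS_solutions n a \<alpha>)}
              \<le> ereal ((real n + 1) / s))
       \<and> (AE \<alpha> in lebesgue. \<alpha> > real n + 1 \<longrightarrow> finite (nontrivial_PS_solutions n a \<alpha>))"
proof -
  define E where "E s t = {\<alpha> \<in> {s..t}. infinite (nontrivial_PS_solutions n a \<alpha>)}" for s t
  have measure: "hausdorff_measure d (E s t) = 0"
    if "real n + 1 < s" "(real n + 1) / s < d" "d < 1" for s t d
    using assms(3)
  proof
    assume "\<forall>i\<in>{1..n}. a i \<ge> 1"
    then show ?thesis
      unfolding E_def using assms(1) that by (intro hausdorff_measure_solutions_ge_1) auto
  next
    assume "(\<Sum>i=1..n. a i) < 1"
    then show ?thesis
      unfolding E_def using assms(2) that by (intro hausdorff_measure_solutions_sum_less_1) auto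
  qed
  have dim: "hausdorff_dim (E s t) \<le> ereal ((real n + 1) / s)" if s: "real n + 1 < s" for s t
  \<comment> \<open>Testing exponents strictly between \<open>(n + 1) / s\<close> and 1 suffices,
    since \<open>s > n + 1\<close> makes this interval non-empty; \<open>measure\<close> applies
    exactly to these.\<close>
  proof (rule dense_ge_bounded)
    show "ereal ((real n + 1) / s) < 1" using s by simp
    fix w :: ereal assume w: "ereal ((real n + 1) / s) < w" "w < 1"
    then obtain d where d: "w = ereal d" by (cases w) auto
    have "(real n + 1) / s > 0" using s by (simp add: field_simps)
    moreover have sd: "(real n + 1) / s < d" "d < 1" using w by (auto simp: d)
    ultimately have "0 \<le> d" by linarith
    with measure[OF s sd] show "hausdorff_dim (E s t) \<le> w"
      unfolding hausdorff_dim_def d by (intro Inf_lower) auto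
  qed
  have neg: "negligible (E s t)" if s: "real n + 1 < s" for s t
  proof -
    have "(real n + 1) / s < 1" using s by simp
    then obtain d where d: "(real n + 1) / s < d" "d < 1" using dense by blast
    moreover have "(real n + 1) / s > 0" using s by (simp add: field_simps)
    ultimately show ?thesis
      using measure[OF s d] by (intro negligible_if_hausdorff_measure_eq_0[of d]) auto
  qed
  \<comment> \<open>The intervals grow with \<open>j\<close> and exhaust all
    \<open>\<alpha> > n + 1\<close>, while each left end stays strictly above \<open>n + 1\<close>,
    as \<open>neg\<close> requires. For small \<open>j\<close> they are empty.\<close>
  define Z where "Z = (\<Union>j::nat. E (real n + 1 + 1 / real (Suc j)) (real j))"
  have "negligible Z"
    unfolding Z_def by (intro negligible_countable_Union) (auto intro!: neg)
  then have "Z \<in> null_sets lebesgue" by (simp add: negligible_iff_null_sets)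
  moreover have "{\<alpha> \<in> space lebesgue. \<not> (\<alpha> > real n + 1 \<longrightarrow> finite (nontrivial_PS_solutions n a \<alpha>))} \<subseteq> Z"
  proof clarsimp
    fix \<alpha> assume \<alpha>: "real n + 1 < \<alpha>" and inf: "infinite (nontrivial_PS_solutions n a \<alpha>)"
    obtain j1 where j1: "inverse (real (Suc j1)) < \<alpha> - (real n + 1)"
      using reals_Archimedean[of "\<alpha> - (real n + 1)"] \<alpha> by auto
    obtain j2 where j2: "\<alpha> \<le> real j2" using real_arch_simple by blast
    define j where "j = max j1 j2"
    have "1 / real (Suc j) \<le> 1 / real (Suc j1)"
      by (intro divide_left_mono) (auto simp: j_def)
    with j1 j2 inf have "\<alpha> \<in> E (real n + 1 + 1 / real (Suc j)) (real j)"
      by (auto simp: E_def j_def inverse_eq_divide)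
    then show "\<alpha> \<in> Z" by (auto simp: Z_def)
  qed
  ultimately have "AE \<alpha> in lebesgue. \<alpha> > real n + 1 \<longrightarrow> finite (nontrivial_PS_solutions n a \<alpha>)"
    by (rule AE_I')
  with dim show ?thesis unfolding E_def by blast
qed

end
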